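(* Consider a completely randomized design with equal group sizes on $N=4m$ units, $m$ a positive integer, i.e. $\bm{W}$ is uniformly distributed on $\mathcal{W}=\{\bm{w}\in\{0,1\}^N:\sum_{i=1}^N w_i=N/2\}$. For $\bm{w}\in\mathcal{W}$ let $\mathcal{G}^*(\bm{w})$ be the set of all substitutes of $\bm{w}$, and let $$\hat V_{\text{sub}} = \frac{4}{N^2}\sum_{\bm{w}\in\mathcal{W}:\ \bm{W}\in\mathcal{G}^*(\bm{w})}\frac{p_{\bm{w}}}{p_{\bm{W}}}\,\frac{1}{|\mathcal{G}^*(\bm{w})|}\,\{\bm{l}(\bm{w})^\top\bm{Y}^{\text{obs}}\}^2 .$$ Then $\hat V_{\text{sub}}=\hat V_{\text{Neyman}}$ (for every realization of $\bm{W}$ and all values of the potential outcomes), where, with $N_t=N_c=N/2$, $$\hat V_{\text{Neyman}}=\frac{1}{N_t(N_t-1)}\sum_{i:W_i=1}(Y_i^{\text{obs}}-\bar Y_t)^2+\frac{1}{N_c(N_c-1)}\sum_{i:W_i=0}(Y_i^{\text{obs}}-\bar Y_c)^2 .$$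
   Context: There are $N$ units with fixed real potential outcomes $Y_i(0),Y_i(1)$; $\bm{W}\in\{0,1\}^N$ is the random treatment assignment, $p_{\bm{w}}=\Pr(\bm{W}=\bm{w})$, and $Y_i^{\text{obs}}=W_iY_i(1)+(1-W_i)Y_i(0)$, $\bm{Y}^{\text{obs}}=(Y_1^{\text{obs}},\dots,Y_N^{\text{obs}})^\top$. $\bar Y_t$ and $\bar Y_c$ are the means of the observed outcomes over $\{i:W_i=1\}$ and $\{i:W_i=0\}$, respectively. A substitute of $\bm{w}\in\mathcal{W}$ is a vector $\tilde{\bm{w}}\in\mathcal{W}$ whose treated set $\{i:\tilde w_i=1\}$ consists of exactly $N/4$ of the units treated under $\bm{w}$ and exactly $N/4$ of the units that are control under $\bm{w}$. $\bm{l}(\bm{w})=(l_1(\bm{w}),\dots,l_N(\bm{w}))^\top$ with $l_i(\bm{w})=1$ if $w_i=1$ and $l_i(\bm{w})=-1$ if $w_i=0$. *)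

theory Defs
  imports "HOL-Probability.Probability_Mass_Function" "HOL-Library.FuncSet"
begin

text \<open>
  The units are \<open>1, \<dots>, N\<close>. A vector of \<open>{0,1}\<^sup>N\<close> is an extensional function in
  \<open>{1..N} \<rightarrow>\<^sub>E {0, 1}\<close>, so that equality of functions is equality of vectors and the set of
  assignments is finite. Group sizes are compared in the reals, so \<open>N / 2\<close> and \<open>N / 4\<close> are exact.
\<close>

definition balanced_assignments :: "nat \<Rightarrow> (nat \<Rightarrow> nat) set" where
  "balanced_assignments N =
     {w \<in> {1..N} \<rightarrow>\<^sub>E {0, 1}. real (\<Sum>i\<in>{1..N}. w i) = real N / 2}"

definition completely_randomized :: "nat \<Rightarrow> (nat \<Rightarrow> nat) pmf" where
  "completely_randomized N = pmf_of_set (balanced_assignments N)"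

definition treated :: "nat \<Rightarrow> (nat \<Rightarrow> nat) \<Rightarrow> nat set" where
  "treated N w = {i \<in> {1..N}. w i = 1}"

definition control :: "nat \<Rightarrow> (nat \<Rightarrow> nat) \<Rightarrow> nat set" where
  "control N w = {i \<in> {1..N}. w i = 0}"

definition substitutes :: "nat \<Rightarrow> (nat \<Rightarrow> nat) \<Rightarrow> (nat \<Rightarrow> nat) set" where
  "substitutes N w =
     {v \<in> balanced_assignments N.
        real (card (treated N v \<inter> treated N w)) = real N / 4 \<and>
        real (card (treated N v \<inter> control N w)) = real N / 4}"

definition observed :: "(nat \<Rightarrow> real) \<Rightarrow> (nat \<Rightarrow> real) \<Rightarrow> (nat \<Rightarrow> nat) \<Rightarrow> nat \<Rightarrow> real" where
  "observed Y0 Y1 w i = real (w i) * Y1 i + (1 - real (w i)) * Y0 i"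

definition sign_vec :: "(nat \<Rightarrow> nat) \<Rightarrow> nat \<Rightarrow> real" where
  "sign_vec w i = (if w i = 1 then 1 else - 1)"

definition mean_on :: "nat set \<Rightarrow> (nat \<Rightarrow> real) \<Rightarrow> real" where
  "mean_on A y = (\<Sum>i\<in>A. y i) / real (card A)"

text \<open>In both estimators, \<open>W\<close> is the realized assignment and \<open>y\<close> the vector of observed
  outcomes under \<open>W\<close>; in the first, \<open>P\<close> is the distribution of the random assignment.\<close>

definition V_sub ::
  "nat \<Rightarrow> (nat \<Rightarrow> nat) pmf \<Rightarrow> (nat \<Rightarrow> nat) \<Rightarrow> (nat \<Rightarrow> real) \<Rightarrow> real" where
  "V_sub N P W y =
     4 / (real N)\<^sup>2 *
     (\<Sum>w \<in> {w \<in> balanced_assignments N. W \<in> substitutes N w}.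
        pmf P w / pmf P W * (1 / real (card (substitutes N w))) *
        (\<Sum>i\<in>{1..N}. sign_vec w i * y i)\<^sup>2)"

definition V_Neyman ::
  "nat \<Rightarrow> real \<Rightarrow> real \<Rightarrow> (nat \<Rightarrow> nat) \<Rightarrow> (nat \<Rightarrow> real) \<Rightarrow> real" where
  "V_Neyman N Nt Nc W y =
     1 / (Nt * (Nt - 1)) * (\<Sum>i\<in>treated N W. (y i - mean_on (treated N W) y)\<^sup>2) +
     1 / (Nc * (Nc - 1)) * (\<Sum>i\<in>control N W. (y i - mean_on (control N W) y)\<^sup>2)"

end

theory Submission
  imports Defs "HOL-Combinatorics.Transposition"
begin

text \<open>
  A substitute of a balanced assignment amounts to an independent choice of half of the treated
  units and half of the control units. Averaging the squared contrast over all substitutes,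
  the cross term between the two groups vanishes, because complementation negates the contrast
  on a group. Within a group \<open>T\<close>, the average product of the signs of two distinct units does
  not depend on the pair; since all signs sum to \<open>0\<close>, it equals \<open>- 1 / (card T - 1)\<close>. Hence each
  group contributes \<open>card T\<close> times its sample variance.
\<close>

section \<open>Signed sums over the half-size subsets of a finite set\<close>

definition halves :: "'a set \<Rightarrow> 'a set set" where
  "halves T = {A. A \<subseteq> T \<and> 2 * card A = card T}"

text \<open>The entry of l(w) at unit \<open>i\<close> when \<open>A\<close> is the treated set.
  Indexing by sets lets each group be treated on its own.\<close>

definition side :: "'a set \<Rightarrow> 'a \<Rightarrow> real" where
  "side A i = (if i \<in> A then 1 else - 1)"

text \<open>The share of the units of \<open>T\<close> in l(w)^T y.\<close>

definition contrast :: "'a set \<Rightarrow> ('a \<Rightarrow> real) \<Rightarrow> 'a set \<Rightarrow> real" where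
  "contrast T y A = (\<Sum>i\<in>T. side A i * y i)"

lemma side_mult_self [simp]: "side A i * side A i = 1"
  by (simp add: side_def)

lemma finite_halves: "finite T \<Longrightarrow> finite (halves T)"
  by (rule finite_subset [of _ "Pow T"]) (auto simp: halves_def)

lemma card_halves:
  assumes "finite T" "card T = 2 * m"
  shows "card (halves T) = (2 * m) choose m"
proof -
  have "halves T = {A. A \<subseteq> T \<and> card A = m}"
    using assms by (auto simp: halves_def)
  then show ?thesis
    using assms n_subsets [of T m] by simp
qed

text \<open>The map \<open>A \<mapsto> T - A\<close> is an involution of \<open>halves T\<close>
  that flips every sign on \<open>T\<close>, so the sum equals its own negative.\<close>

lemma sum_contrast_halves:
  assumes "finite T"
  shows "(\<Sum>A\<in>halves T. contrast T y A) = 0"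
proof -
  have compl: "T - A \<in> halves T" if "A \<in> halves T" for A
    using that assms finite_subset [of A T] by (auto simp: halves_def card_Diff_subset)
  have "(\<Sum>A\<in>halves T. contrast T y A) = (\<Sum>A\<in>halves T. - contrast T y A)"
  proof (rule sum.reindex_bij_witness [of _ "\<lambda>A. T - A" "\<lambda>A. T - A"])
    fix A assume "A \<in> halves T"
    show "- contrast T y (T - A) = contrast T y A"
      unfolding contrast_def sum_negf [symmetric] by (rule sum.cong) (auto simp: side_def)
  qed (use compl in \<open>auto simp: halves_def\<close>)
  then show ?thesis by (simp add: sum_negf)
qed

lemma sum_side_halves:
  assumes "finite T" "A \<in> halves T"
  shows "(\<Sum>j\<in>T. side A j) = 0"
proof -
  have sub: "A \<subseteq> T" and two: "2 * card A = card T" using assms by (auto simp: halves_def)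
  have "(\<Sum>j\<in>T. side A j) = (\<Sum>j\<in>A. side A j) + (\<Sum>j\<in>T - A. side A j)"
    using sum.subset_diff [OF sub assms(1)] by (simp add: add.commute)
  also have "\<dots> = real (card A) - real (card (T - A))"
    by (simp add: side_def)
  also have "\<dots> = 0"
    using two sub assms(1) finite_subset [of A T] by (simp add: card_Diff_subset)
  finally show ?thesis .
qed

text \<open>The transposition of \<open>j\<close> and \<open>k\<close> maps \<open>T\<close> to
  itself and fixes \<open>i\<close>, so it permutes \<open>halves T\<close> while exchanging the
  roles of \<open>j\<close> and \<open>k\<close>.\<close>

lemma sum_side_mult_swap:
  assumes "i \<noteq> j" "i \<noteq> k" "j \<in> T" "k \<in> T"
  shows "(\<Sum>A\<in>halves T. side A i * side A j) = (\<Sum>A\<in>halves T. side A i * side A k)"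
proof -
  let ?t = "Transposition.transpose j k"
  have mem: "?t ` A \<in> halves T" if "A \<in> halves T" for A
  proof -
    have "?t ` A \<subseteq> T"
      using that assms by (auto simp: halves_def Transposition.transpose_def)
    moreover have "card (?t ` A) = card A"
      by (rule card_image) (metis inj_on_subset inj_transpose subset_UNIV)
    ultimately show ?thesis using that by (simp add: halves_def)
  qed
  have img: "x \<in> ?t ` A \<longleftrightarrow> ?t x \<in> A" for x A
    by (metis image_iff transpose_involutory)
  show ?thesis
  proof (rule sum.reindex_bij_witness [of _ "image ?t" "image ?t"])
    fix A assume "A \<in> halves T"
    show "side (?t ` A) i * side (?t ` A) k = side A i * side A j"
      using assms by (simp add: side_def img)
  qed (auto simp: mem image_comp)
qed

text \<open>For fixed \<open>i\<close>, the sums \<open>?c k\<close> over all \<open>k\<close> in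
  \<open>T\<close> add up to 0, because the signs of each half do. The term \<open>k = i\<close> is
  \<open>card (halves T)\<close>, since signs square to 1, and the other \<open>card T - 1\<close>
  terms all equal \<open>?c j\<close>.\<close>

lemma sum_side_mult_halves:
  assumes "finite T" "i \<in> T" "j \<in> T" "i \<noteq> j"
  shows "(real (card T) - 1) * (\<Sum>A\<in>halves T. side A i * side A j) = - real (card (halves T))"
proof -
  let ?c = "\<lambda>k. \<Sum>A\<in>halves T. side A i * side A k"
  have "(\<Sum>k\<in>T. ?c k) = (\<Sum>A\<in>halves T. side A i * (\<Sum>k\<in>T. side A k))"
    by (subst sum.swap) (simp add: sum_distrib_left)
  then have "(\<Sum>k\<in>T. ?c k) = 0"
    using sum_side_halves [OF assms(1)] by simp
  moreover have "(\<Sum>k\<in>T. ?c k) = ?c i + (\<Sum>k\<in>T - {i}. ?c k)"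
    using assms by (simp add: sum.remove)
  moreover have "(\<Sum>k\<in>T - {i}. ?c k) = (\<Sum>k\<in>T - {i}. ?c j)"
    by (rule sum.cong) (use assms in \<open>auto intro: sum_side_mult_swap\<close>)
  moreover have "real (card (T - {i})) = real (card T) - 1"
    using card_Suc_Diff1 [OF assms(1,2)] by linarith
  ultimately show ?thesis by simp
qed

lemma sum_deviation_square:
  assumes "finite T" "T \<noteq> {}"
  shows "real (card T) * (\<Sum>i\<in>T. (y i - mean_on T y)\<^sup>2)
         = real (card T) * (\<Sum>i\<in>T. (y i)\<^sup>2) - (\<Sum>i\<in>T. y i)\<^sup>2"
proof -
  have n: "real (card T) \<noteq> 0" using assms by simp
  have "(\<Sum>i\<in>T. (y i - mean_on T y)\<^sup>2)
      = (\<Sum>i\<in>T. (y i)\<^sup>2 - 2 * mean_on T y * y i + (mean_on T y)\<^sup>2)"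
    by (rule sum.cong) (auto simp: power2_eq_square algebra_simps)
  also have "\<dots> = (\<Sum>i\<in>T. (y i)\<^sup>2) - 2 * mean_on T y * (\<Sum>i\<in>T. y i)
      + real (card T) * (mean_on T y)\<^sup>2"
    by (simp add: sum.distrib sum_subtractf sum_distrib_left)
  finally show ?thesis
    using n by (simp add: mean_on_def field_simps power2_eq_square)
qed

text \<open>Expanding the square leaves only sums of products of two signs, known up to the factor
  \<open>card T - 1\<close>. The resulting quadratic form in \<open>y\<close> is the sum of squared
  deviations, scaled by the size of \<open>T\<close> and the number of halves.\<close>

lemma sum_contrast_square_halves:
  assumes "finite T" "T \<noteq> {}"
  shows "(real (card T) - 1) * (\<Sum>A\<in>halves T. (contrast T y A)\<^sup>2)
    = real (card (halves T)) * (real (card T) * (\<Sum>i\<in>T. (y i - mean_on T y)\<^sup>2))"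
proof -
  let ?n = "real (card T)" and ?H = "real (card (halves T))"
  have "(\<Sum>A\<in>halves T. (contrast T y A)\<^sup>2)
      = (\<Sum>A\<in>halves T. \<Sum>i\<in>T. \<Sum>j\<in>T. y i * y j * (side A i * side A j))"
    by (simp add: contrast_def power2_eq_square sum_product mult_ac)
  also have "\<dots> = (\<Sum>i\<in>T. \<Sum>j\<in>T. y i * y j * (\<Sum>A\<in>halves T. side A i * side A j))"
    by (simp add: sum_distrib_left sum.swap [of _ _ "halves T"])
  finally have "(?n - 1) * (\<Sum>A\<in>halves T. (contrast T y A)\<^sup>2)
      = (\<Sum>i\<in>T. \<Sum>j\<in>T. y i * y j * ((?n - 1) * (\<Sum>A\<in>halves T. side A i * side A j)))"
    by (simp add: sum_distrib_left mult_ac)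
  \<comment> \<open>The diagonal weight (n - 1) H is written as n H - H. The weight - H is then
    common to all pairs, and that part of the double sum collapses to the square of the
    total.\<close>
  also have "\<dots> = (\<Sum>i\<in>T. \<Sum>j\<in>T. (if j = i then ?n * ?H * (y i)\<^sup>2 else 0) - ?H * (y i * y j))"
  proof (intro sum.cong refl)
    fix i j assume "i \<in> T" "j \<in> T"
    then show "y i * y j * ((?n - 1) * (\<Sum>A\<in>halves T. side A i * side A j))
        = (if j = i then ?n * ?H * (y i)\<^sup>2 else 0) - ?H * (y i * y j)"
      using sum_side_mult_halves [OF assms(1), of i j]
      by (cases "j = i") (simp add: power2_eq_square algebra_simps, simp)
  qed
  also have "\<dots> = ?H * (?n * (\<Sum>i\<in>T. (y i)\<^sup>2) - (\<Sum>i\<in>T. y i)\<^sup>2)"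
    using assms(1)
    by (simp add: sum_subtractf sum_distrib_left power2_eq_square sum_product algebra_simps)
  finally show ?thesis
    unfolding sum_deviation_square [OF assms] .
qed

section \<open>Balanced assignments and their substitutes\<close>

lemma sum_treated_eq_card:
  assumes "w \<in> {1..N} \<rightarrow>\<^sub>E {0, 1}"
  shows "(\<Sum>i\<in>{1..N}. w i) = card (treated N w)"
proof -
  have "(\<Sum>i\<in>{1..N}. w i) = (\<Sum>i\<in>{1..N}. if w i = 1 then 1 else 0)"
    using assms by (intro sum.cong) (auto simp: PiE_iff)
  also have "\<dots> = card (treated N w)"
    by (simp add: treated_def sum.If_cases Int_def)
  finally show ?thesis .
qed

lemma balanced_assignments_iff:
  "w \<in> balanced_assignments N \<longleftrightarrow> w \<in> {1..N} \<rightarrow>\<^sub>E {0, 1} \<and> 2 * card (treated N w) = N"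
proof (cases "w \<in> {1..N} \<rightarrow>\<^sub>E {0, 1}")
  case True
  have "real k = real N / 2 \<longleftrightarrow> 2 * k = N" for k
    by auto
  then show ?thesis
    by (simp only: balanced_assignments_def mem_Collect_eq sum_treated_eq_card [OF True])
next
  case False
  then show ?thesis
    by (simp only: balanced_assignments_def mem_Collect_eq simp_thms)
qed

lemma finite_balanced_assignments: "finite (balanced_assignments N)"
  by (rule finite_subset [of _ "{1..N} \<rightarrow>\<^sub>E {0, 1}"])
    (auto simp: balanced_assignments_def intro: finite_PiE)

lemma finite_treated [simp]: "finite (treated N w)"
  and finite_control [simp]: "finite (control N w)"
  by (auto simp: treated_def control_def)

lemma treated_control_disjoint: "treated N w \<inter> control N w = {}"
  by (auto simp: treated_def control_def)

lemma treated_control_union: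
  assumes "w \<in> balanced_assignments N"
  shows "treated N w \<union> control N w = {1..N}"
  using assms by (auto simp: balanced_assignments_iff treated_def control_def PiE_iff)

lemma card_treated_Int_split:
  assumes "w \<in> balanced_assignments N"
  shows "card (treated N v \<inter> treated N w) + card (treated N v \<inter> control N w) = card (treated N v)"
proof -
  have "treated N v = (treated N v \<inter> treated N w) \<union> (treated N v \<inter> control N w)"
    using treated_control_union [OF assms] by (auto simp: treated_def [of N v])
  then show ?thesis
    using treated_control_disjoint [of N w]
    by (metis (no_types, lifting) card_Un_disjoint finite_Int finite_treated inf_assoc
        inf_bot_right inf_left_commute)
qed

lemma card_control:
  assumes "w \<in> balanced_assignments N"
  shows "2 * card (control N w) = N"
  using card_Un_disjoint [of "treated N w" "control N w"] assms
  by (simp add: treated_control_disjoint treated_control_union balanced_assignments_iff)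

text \<open>The N/2 units treated under a balanced \<open>v\<close> split between the two groups of
  \<open>w\<close>, so the overlap with one group determines the overlap with the other. The form
  chosen here is symmetric in \<open>v\<close> and \<open>w\<close>.\<close>

lemma substitutes_iff:
  assumes "w \<in> balanced_assignments N"
  shows "v \<in> substitutes N w \<longleftrightarrow>
    v \<in> balanced_assignments N \<and> 4 * card (treated N v \<inter> treated N w) = N"
  using card_treated_Int_split [OF assms, of v]
  by (auto simp: substitutes_def balanced_assignments_iff field_simps simp flip: of_nat_mult)

text \<open>Being a substitute is a symmetric relation, which turns the index set of
  \<open>V_sub\<close> into the set of substitutes of the realized assignment.\<close>

lemma substitutes_sym:
  assumes "w \<in> balanced_assignments N"
  shows "{v \<in> balanced_assignments N. w \<in> substitutes N v} = substitutes N w"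
  using assms by (auto simp: substitutes_iff Int_commute)

text \<open>An assignment is determined by its treated set, and the two groups of \<open>w\<close>
  partition the units. The inverse sends a pair of halves to the indicator of their union.\<close>

lemma bij_betw_substitutes:
  assumes "w \<in> balanced_assignments N"
  shows "bij_betw (\<lambda>v. (treated N v \<inter> treated N w, treated N v \<inter> control N w))
    (substitutes N w) (halves (treated N w) \<times> halves (control N w))"
proof (rule bij_betw_byWitness
    [where f' = "\<lambda>(A, B). \<lambda>i\<in>{1..N}. if i \<in> A \<union> B then 1 else 0"])
  have w: "treated N w \<union> control N w = {1..N}" by (rule treated_control_union [OF assms])
  have T: "2 * card (treated N w) = N" using assms by (simp add: balanced_assignments_iff)
  have C: "2 * card (control N w) = N" by (rule card_control [OF assms])
  show "\<forall>v\<in>substitutes N w. (\<lambda>(A, B). \<lambda>i\<in>{1..N}. if i \<in> A \<union> B then 1 else 0)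
      (treated N v \<inter> treated N w, treated N v \<inter> control N w) = v"
  proof
    fix v assume "v \<in> substitutes N w"
    then have v: "v \<in> {1..N} \<rightarrow>\<^sub>E {0, 1}"
      by (simp add: substitutes_def balanced_assignments_iff)
    have "treated N v \<inter> treated N w \<union> treated N v \<inter> control N w = treated N v"
      using w by (auto simp: treated_def [of N v])
    moreover have "(\<lambda>i\<in>{1..N}. if i \<in> treated N v then 1 else 0) = v"
    proof
      \<comment> \<open>Outside \<open>{1..N}\<close> both sides are \<open>undefined\<close>, as
        \<open>v\<close> is extensional.\<close>
      fix i show "(\<lambda>i\<in>{1..N}. if i \<in> treated N v then 1 else 0) i = v i"
        using v by (cases "i \<in> {1..N}") (auto simp: treated_def PiE_iff extensional_def)
    qed
    ultimately show "(\<lambda>(A, B). \<lambda>i\<in>{1..N}. if i \<in> A \<union> B then 1 else 0)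
        (treated N v \<inter> treated N w, treated N v \<inter> control N w) = v"
      by (simp only: prod.case)
  qed
  have treated_indicator: "treated N (\<lambda>i\<in>{1..N}. if i \<in> A \<union> B then 1 else 0) = A \<union> B"
    if "A \<in> halves (treated N w)" "B \<in> halves (control N w)" for A B
    using that w by (auto simp: halves_def treated_def [of N "restrict _ _"] split: if_splits)
  show "\<forall>p\<in>halves (treated N w) \<times> halves (control N w).
      (\<lambda>v. (treated N v \<inter> treated N w, treated N v \<inter> control N w))
        ((\<lambda>(A, B). \<lambda>i\<in>{1..N}. if i \<in> A \<union> B then 1 else 0) p) = p"
    using treated_control_disjoint [of N w]
    by (clarsimp simp: treated_indicator simp del: One_nat_def Un_iff) (auto simp: halves_def)
  show "(\<lambda>v. (treated N v \<inter> treated N w, treated N v \<inter> control N w)) ` substitutes N w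
      \<subseteq> halves (treated N w) \<times> halves (control N w)"
    using T C card_treated_Int_split [OF assms]
    by (auto simp: halves_def substitutes_def field_simps simp flip: of_nat_mult)
  show "(\<lambda>(A, B). \<lambda>i\<in>{1..N}. if i \<in> A \<union> B then 1 else 0) `
      (halves (treated N w) \<times> halves (control N w)) \<subseteq> substitutes N w"
  proof clarify
    fix A B assume A: "A \<in> halves (treated N w)" and B: "B \<in> halves (control N w)"
    let ?v = "\<lambda>i\<in>{1..N}. if i \<in> A \<union> B then 1 else (0::nat)"
    have v: "treated N ?v = A \<union> B" by (rule treated_indicator [OF A B])
    have disj: "A \<inter> B = {}" "(A \<union> B) \<inter> treated N w = A"
      using A B treated_control_disjoint [of N w] by (auto simp: halves_def)
    have "finite A" "finite B"
      using A B by (auto simp: halves_def intro: finite_subset [OF _ finite_treated]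
          finite_subset [OF _ finite_control])
    then have "card (A \<union> B) = card A + card B"
      using disj by (simp add: card_Un_disjoint)
    then show "?v \<in> substitutes N w"
      unfolding substitutes_iff [OF assms] balanced_assignments_iff v disj
      using A B T C by (auto simp: halves_def)
  qed
qed

text \<open>Each group has 2m units, of which m are chosen independently. The count is the same for
  every \<open>w\<close>, so the weights in \<open>V_sub\<close> are constant.\<close>

lemma card_substitutes:
  assumes "w \<in> balanced_assignments (4 * m)"
  shows "card (substitutes (4 * m) w) = ((2 * m) choose m)\<^sup>2"
  using bij_betw_same_card [OF bij_betw_substitutes [OF assms]] assms card_control [OF assms]
  by (simp add: card_cartesian_product card_halves balanced_assignments_iff power2_eq_square)

section \<open>Splitting the squared contrast between the two groups\<close>

lemma sum_sign_vec:
  assumes "w \<in> balanced_assignments N"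
  shows "(\<Sum>i\<in>{1..N}. sign_vec v i * y i)
    = contrast (treated N w) y (treated N v \<inter> treated N w)
      + contrast (control N w) y (treated N v \<inter> control N w)"
proof -
  have "(\<Sum>i\<in>{1..N}. sign_vec v i * y i)
      = (\<Sum>i\<in>treated N w. sign_vec v i * y i) + (\<Sum>i\<in>control N w. sign_vec v i * y i)"
    unfolding treated_control_union [OF assms, symmetric]
    by (rule sum.union_disjoint) (simp_all add: treated_control_disjoint)
  moreover have "(\<Sum>i\<in>treated N w. sign_vec v i * y i)
      = contrast (treated N w) y (treated N v \<inter> treated N w)"
    unfolding contrast_def
    by (rule sum.cong) (auto simp: side_def sign_vec_def treated_def)
  moreover have "(\<Sum>i\<in>control N w. sign_vec v i * y i)
      = contrast (control N w) y (treated N v \<inter> control N w)"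
    unfolding contrast_def
    by (rule sum.cong) (auto simp: side_def sign_vec_def treated_def control_def)
  ultimately show ?thesis by simp
qed

text \<open>The cross term factors into 2 times the product of the sums of \<open>f\<close> and
  \<open>g\<close>, and the first of these is 0.\<close>

lemma sum_square_add_times:
  fixes f :: "'a \<Rightarrow> real" and g :: "'b \<Rightarrow> real"
  assumes "(\<Sum>a\<in>A. f a) = 0"
  shows "(\<Sum>(a, b)\<in>A \<times> B. (f a + g b)\<^sup>2)
    = real (card B) * (\<Sum>a\<in>A. (f a)\<^sup>2) + real (card A) * (\<Sum>b\<in>B. (g b)\<^sup>2)"
proof -
  have "(\<Sum>(a, b)\<in>A \<times> B. (f a + g b)\<^sup>2)
      = (\<Sum>a\<in>A. real (card B) * (f a)\<^sup>2 + (\<Sum>b\<in>B. (g b)\<^sup>2) + 2 * f a * (\<Sum>b\<in>B. g b))"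
    by (simp add: sum.cartesian_product [symmetric] power2_sum sum.distrib sum_distrib_left)
  also have "\<dots> = real (card B) * (\<Sum>a\<in>A. (f a)\<^sup>2) + real (card A) * (\<Sum>b\<in>B. (g b)\<^sup>2)
      + 2 * (\<Sum>a\<in>A. f a) * (\<Sum>b\<in>B. g b)"
    by (simp add: sum.distrib mult.assoc flip: sum_distrib_left sum_distrib_right)
  finally show ?thesis using assms by simp
qed

text \<open>Treating the first 2m units is balanced. Nonemptiness makes \<open>pmf_of_set\<close>
  the genuine uniform distribution.\<close>

lemma balanced_assignments_nonempty: "balanced_assignments (4 * m) \<noteq> {}"
proof -
  let ?w = "\<lambda>i\<in>{1..4 * m}. if i \<le> 2 * m then 1 else (0::nat)"
  have "treated (4 * m) ?w = {1..2 * m}"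
    by (auto simp: treated_def split: if_splits)
  then have "?w \<in> balanced_assignments (4 * m)"
    by (auto simp: balanced_assignments_iff)
  then show ?thesis by blast
qed

section \<open>Equality of the two variance estimators\<close>

theorem theorem4p2:
  fixes m N :: nat and Y0 Y1 :: "nat \<Rightarrow> real" and W :: "nat \<Rightarrow> nat"
  assumes "m \<ge> 1" and "N = 4 * m"
    and "W \<in> set_pmf (completely_randomized N)"
  shows "V_sub N (completely_randomized N) W (observed Y0 Y1 W)
         = V_Neyman N (real N / 2) (real N / 2) W (observed Y0 Y1 W)"
proof -
  define y where "y = observed Y0 Y1 W"
  define T where "T = treated N W"
  define C where "C = control N W"
  define K where "K = real ((2 * m) choose m)"
  define n where "n = real (2 * m)"
  note fin = finite_balanced_assignments [of N]
  have ne: "balanced_assignments N \<noteq> {}"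
    using balanced_assignments_nonempty assms(2) by simp
  have W: "W \<in> balanced_assignments N"
    using assms(3) fin ne by (simp add: completely_randomized_def)
  have cards: "card T = 2 * m" "card C = 2 * m"
    using W card_control [OF W] assms(2) by (auto simp: T_def C_def balanced_assignments_iff)
  have finTC: "finite T" "finite C" by (simp_all add: T_def C_def)
  have K: "real (card (halves T)) = K" "real (card (halves C)) = K"
    using finTC cards by (simp_all add: K_def card_halves)
  have "K > 0" by (simp add: K_def)
  \<comment> \<open>Each group has at least two units, so division by \<open>n - 1\<close> is
    legitimate.\<close>
  have "n > 1" using assms(1) by (simp add: n_def)
  have half: "real N / 2 = n" using assms(2) by (simp add: n_def)
  define D where "D = (\<lambda>S. \<Sum>i\<in>S. (y i - mean_on S y)\<^sup>2)"
  have var: "(\<Sum>A\<in>halves S. (contrast S y A)\<^sup>2) = K * n * D S / (n - 1)"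
    if "finite S" "card S = 2 * m" for S
  proof -
    have "S \<noteq> {}" using that assms(1) by auto
    from sum_contrast_square_halves [OF that(1) this, of y]
    have "(n - 1) * (\<Sum>A\<in>halves S. (contrast S y A)\<^sup>2) = K * (n * D S)"
      using that by (simp add: card_halves K_def n_def D_def)
    then show ?thesis using \<open>n > 1\<close> by (simp add: field_simps)
  qed
  have "(\<Sum>w\<in>substitutes N W. (\<Sum>i\<in>{1..N}. sign_vec w i * y i)\<^sup>2)
      = (\<Sum>(A, B)\<in>halves T \<times> halves C. (contrast T y A + contrast C y B)\<^sup>2)"
    unfolding T_def C_def
    by (subst sum.reindex_bij_betw [OF bij_betw_substitutes [OF W], symmetric])
      (simp add: sum_sign_vec [OF W] del: One_nat_def)
  \<comment> \<open>Each group's sum is repeated once for every half of the other group, which gives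
    the outer factor \<open>K\<close>.\<close>
  also have "\<dots> = K * (K * n * D T / (n - 1)) + K * (K * n * D C / (n - 1))"
    by (simp add: sum_square_add_times sum_contrast_halves finTC K var cards)
  finally have total: "(\<Sum>w\<in>substitutes N W. (\<Sum>i\<in>{1..N}. sign_vec w i * y i)\<^sup>2)
      = K\<^sup>2 * n / (n - 1) * (D T + D C)"
    by (simp add: power2_eq_square algebra_simps add_divide_distrib)
  have "V_sub N (completely_randomized N) W y
      = 4 / (real N)\<^sup>2 * (\<Sum>w\<in>substitutes N W. 1 / K\<^sup>2 * (\<Sum>i\<in>{1..N}. sign_vec w i * y i)\<^sup>2)"
    unfolding V_sub_def substitutes_sym [OF W]
  proof (rule arg_cong [where f = "(*) _"], rule sum.cong [OF refl])
    fix w assume "w \<in> substitutes N W"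
    then have w: "w \<in> balanced_assignments N" by (simp add: substitutes_def)
    \<comment> \<open>Under the uniform design all assignments are equally likely, so the
      probability ratio drops out.\<close>
    have "pmf (completely_randomized N) w / pmf (completely_randomized N) W = 1"
      using fin ne w W by (simp add: completely_randomized_def)
    moreover have "real (card (substitutes N w)) = K\<^sup>2"
      using card_substitutes [of w m] w assms(2) by (simp add: K_def)
    ultimately show "pmf (completely_randomized N) w / pmf (completely_randomized N) W
        * (1 / real (card (substitutes N w))) * (\<Sum>i\<in>{1..N}. sign_vec w i * y i)\<^sup>2
        = 1 / K\<^sup>2 * (\<Sum>i\<in>{1..N}. sign_vec w i * y i)\<^sup>2"
      by simp
  qed
  also have "\<dots> = 4 / (real N)\<^sup>2 * (1 / K\<^sup>2 * (K\<^sup>2 * n / (n - 1) * (D T + D C)))"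
    unfolding sum_distrib_left [symmetric] total ..
  \<comment> \<open>The number K^2 of substitutes cancels, and 4 / N^2 = 1 / n^2 because
    \<open>n\<close> is N/2.\<close>
  also have "\<dots> = 1 / n\<^sup>2 * (n / (n - 1) * (D T + D C))"
    using \<open>K > 0\<close> by (simp add: half [symmetric] power_divide)
  also have "\<dots> = 1 / (n * (n - 1)) * D T + 1 / (n * (n - 1)) * D C"
    using \<open>n > 1\<close> by (simp add: power2_eq_square distrib_left)
  also have "\<dots> = V_Neyman N (real N / 2) (real N / 2) W y"
    by (simp add: V_Neyman_def half D_def T_def C_def)
  finally show ?thesis unfolding y_def .
qed

end
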